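(* Let $\mathbb{K}$ be a field of characteristic zero and $R$ a unital commutative associative $\mathbb{K}$-algebra. Let $X,Y\in T_R$ be such that the $R$-bilinear mapping $$\Omega^1_R\times\Omega^1_R\to R,\quad(\alpha_1,\alpha_2)\mapsto\langle\alpha_1,Y\rangle\langle\alpha_2,[X,[X,Y]]\rangle$$ is symmetric. If we define $$[\alpha_1,\alpha_2]:=\langle\alpha_1,Y\rangle\pounds_X\alpha_2-\langle\alpha_2,Y\rangle\pounds_X\alpha_1-\langle\alpha_1,[X,Y]\rangle\alpha_2+\langle\alpha_2,[X,Y]\rangle\alpha_1$$ for all $\alpha_1,\alpha_2\in\Omega^1_R$, then we obtain a Lie-Rinehart algebra structure on $\Omega^1_R$ with the anchor $\rho\colon\Omega^1_R\to T_R$, $\rho(\alpha):=\langle\alpha,Y\rangle X$.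
   Context: $T_R:=\mathrm{Der}(R)$ is the $R$-module and Lie algebra (under commutators) of all $\mathbb{K}$-linear derivations $R\to R$; $\Omega^1_R:=\mathrm{Hom}_R(T_R,R)$; $\langle\alpha,X\rangle:=\alpha(X)$ for $\alpha\in\Omega^1_R$, $X\in T_R$. For $X\in T_R$ the Lie derivative $\pounds_X\colon\Omega^1_R\to\Omega^1_R$ is $(\pounds_X\alpha)(Z):=X(\alpha(Z))-\alpha([X,Z])$ for $Z\in T_R$. A Lie-Rinehart algebra structure (equivalently, $(\mathbb{K},R)$-Lie algebra structure) on a unital left $R$-module $L$ with an $R$-linear map $\rho\colon L\to T_R$ (the anchor) is a Lie algebra structure $[\cdot,\cdot]$ on $L$ over $\mathbb{K}$ such that $\rho$ is a Lie algebra homomorphism and $[\ell_1,r\cdot\ell_2]=r\cdot[\ell_1,\ell_2]+(\rho(\ell_1)r)\cdot\ell_2$ for all $r\in R$, $\ell_1,\ell_2\in L$. *)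

theory Defs
  imports "HOL-Algebra.Module"
begin

definition char_zero :: "('k, 'x) ring_scheme \<Rightarrow> bool" where
  "char_zero K \<longleftrightarrow> (\<forall>n::nat. n > 0 \<longrightarrow> [n] \<cdot>\<^bsub>K\<^esub> \<one>\<^bsub>K\<^esub> \<noteq> \<zero>\<^bsub>K\<^esub>)"


section \<open>Module homomorphisms and modules of maps\<close>

text \<open>As for \<^const>\<open>hom\<close>, only the values on the carrier of \<open>M\<close> are constrained.\<close>

definition mod_hom ::
  "('r, 'x) ring_scheme \<Rightarrow> ('r, 'a, 'y) module_scheme \<Rightarrow> ('r, 'b, 'z) module_scheme \<Rightarrow> ('a \<Rightarrow> 'b) set"
where
  "mod_hom R M N = {f \<in> carrier M \<rightarrow> carrier N.
     (\<forall>x\<in>carrier M. \<forall>y\<in>carrier M. f (x \<oplus>\<^bsub>M\<^esub> y) = f x \<oplus>\<^bsub>N\<^esub> f y) \<and>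
     (\<forall>r\<in>carrier R. \<forall>x\<in>carrier M. f (r \<odot>\<^bsub>M\<^esub> x) = r \<odot>\<^bsub>N\<^esub> f x)}"

text \<open>
  A set \<open>F\<close> of maps from \<open>A\<close> to \<open>R\<close> as an \<open>R\<close>-module under the pointwise operations. The members
  of \<open>F\<close> are to be extensional on \<open>A\<close>, so that equality of maps is equality on \<open>A\<close>. The
  multiplicative components of the record play no role in a module.
\<close>

definition pointwise_module ::
  "('r, 'x) ring_scheme \<Rightarrow> 'a set \<Rightarrow> ('a \<Rightarrow> 'r) set \<Rightarrow> ('r, 'a \<Rightarrow> 'r) module"
where
  "pointwise_module R A F = \<lparr>
     carrier = F,
     mult = undefined,
     one = undefined,
     zero = (\<lambda>a\<in>A. \<zero>\<^bsub>R\<^esub>),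
     add = (\<lambda>f g. \<lambda>a\<in>A. f a \<oplus>\<^bsub>R\<^esub> g a),
     smult = (\<lambda>r f. \<lambda>a\<in>A. r \<otimes>\<^bsub>R\<^esub> f a)\<rparr>"

text \<open>\<open>R\<close> as a module over itself.\<close>

definition regular_module :: "('r, 'x) ring_scheme \<Rightarrow> ('r, 'r) module" where
  "regular_module R = \<lparr>
     carrier = carrier R,
     mult = mult R,
     one = one R,
     zero = zero R,
     add = add R,
     smult = mult R\<rparr>"

text \<open>
  For a \<open>K\<close>-algebra \<open>R\<close>, every \<open>R\<close>-module is a \<open>K\<close>-module via \<open>k \<mapsto> k \<odot> \<one>\<close>.
\<close>

definition restrict_scalars ::
  "('k, 'r, 'x) module_scheme \<Rightarrow> ('r, 'a, 'y) module_scheme \<Rightarrow> ('k, 'a) module"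
where
  "restrict_scalars R M = \<lparr>
     carrier = carrier M,
     mult = mult M,
     one = one M,
     zero = zero M,
     add = add M,
     smult = (\<lambda>k m. (k \<odot>\<^bsub>R\<^esub> \<one>\<^bsub>R\<^esub>) \<odot>\<^bsub>M\<^esub> m)\<rparr>"


section \<open>Derivations and one-forms\<close>

definition derivations ::
  "('k, 'x) ring_scheme \<Rightarrow> ('k, 'r, 'y) module_scheme \<Rightarrow> ('r \<Rightarrow> 'r) set"
where
  "derivations K R = {D \<in> mod_hom K R R \<inter> extensional (carrier R).
     \<forall>a\<in>carrier R. \<forall>b\<in>carrier R. D (a \<otimes>\<^bsub>R\<^esub> b) = D a \<otimes>\<^bsub>R\<^esub> b \<oplus>\<^bsub>R\<^esub> a \<otimes>\<^bsub>R\<^esub> D b}"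

definition Der ::
  "('k, 'x) ring_scheme \<Rightarrow> ('k, 'r, 'y) module_scheme \<Rightarrow> ('r, 'r \<Rightarrow> 'r) module"
where
  "Der K R = pointwise_module R (carrier R) (derivations K R)"

definition commutator ::
  "('r, 'x) ring_scheme \<Rightarrow> ('r \<Rightarrow> 'r) \<Rightarrow> ('r \<Rightarrow> 'r) \<Rightarrow> 'r \<Rightarrow> 'r"
where
  "commutator R X Y = (\<lambda>a\<in>carrier R. X (Y a) \<ominus>\<^bsub>R\<^esub> Y (X a))"

text \<open>The dual module \<open>Hom\<^sub>R(T\<^sub>R, R)\<close> of \<open>T\<^sub>R = Der K R\<close>.\<close>

definition Omega1 ::
  "('k, 'x) ring_scheme \<Rightarrow> ('k, 'r, 'y) module_scheme \<Rightarrow> ('r, ('r \<Rightarrow> 'r) \<Rightarrow> 'r) module"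
where
  "Omega1 K R = pointwise_module R (carrier (Der K R))
     (mod_hom R (Der K R) (regular_module R) \<inter> extensional (carrier (Der K R)))"

definition pairing :: "('a \<Rightarrow> 'r) \<Rightarrow> 'a \<Rightarrow> 'r" (\<open>\<langle>_, _\<rangle>\<close>) where
  "\<langle>\<alpha>, X\<rangle> = \<alpha> X"

definition lie_derivative ::
  "('k, 'x) ring_scheme \<Rightarrow> ('k, 'r, 'y) module_scheme \<Rightarrow> ('r \<Rightarrow> 'r) \<Rightarrow>
     (('r \<Rightarrow> 'r) \<Rightarrow> 'r) \<Rightarrow> ('r \<Rightarrow> 'r) \<Rightarrow> 'r"
where
  "lie_derivative K R X \<alpha> =
     (\<lambda>Z\<in>carrier (Der K R). X (\<alpha> Z) \<ominus>\<^bsub>R\<^esub> \<alpha> (commutator R X Z))"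


section \<open>Lie algebras and Lie-Rinehart algebras\<close>

locale lie_algebra = module K L for K (structure) and L (structure) +
  fixes bracket :: "'l \<Rightarrow> 'l \<Rightarrow> 'l" (\<open>\<lbrakk>_, _\<rbrakk>\<close>)
  constrains L :: "('k, 'l, 'y) module_scheme"
  assumes bracket_closed: "x \<in> carrier L \<Longrightarrow> y \<in> carrier L \<Longrightarrow> \<lbrakk>x, y\<rbrakk> \<in> carrier L"
    and bracket_add_left:
      "x \<in> carrier L \<Longrightarrow> y \<in> carrier L \<Longrightarrow> z \<in> carrier L \<Longrightarrow>
       \<lbrakk>x \<oplus>\<^bsub>L\<^esub> y, z\<rbrakk> = \<lbrakk>x, z\<rbrakk> \<oplus>\<^bsub>L\<^esub> \<lbrakk>y, z\<rbrakk>"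
    and bracket_add_right:
      "x \<in> carrier L \<Longrightarrow> y \<in> carrier L \<Longrightarrow> z \<in> carrier L \<Longrightarrow>
       \<lbrakk>x, y \<oplus>\<^bsub>L\<^esub> z\<rbrakk> = \<lbrakk>x, y\<rbrakk> \<oplus>\<^bsub>L\<^esub> \<lbrakk>x, z\<rbrakk>"
    and bracket_smult_left:
      "k \<in> carrier K \<Longrightarrow> x \<in> carrier L \<Longrightarrow> y \<in> carrier L \<Longrightarrow>
       \<lbrakk>k \<odot>\<^bsub>L\<^esub> x, y\<rbrakk> = k \<odot>\<^bsub>L\<^esub> \<lbrakk>x, y\<rbrakk>"
    and bracket_smult_right:
      "k \<in> carrier K \<Longrightarrow> x \<in> carrier L \<Longrightarrow> y \<in> carrier L \<Longrightarrow>
       \<lbrakk>x, k \<odot>\<^bsub>L\<^esub> y\<rbrakk> = k \<odot>\<^bsub>L\<^esub> \<lbrakk>x, y\<rbrakk>"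
    and bracket_alternating: "x \<in> carrier L \<Longrightarrow> \<lbrakk>x, x\<rbrakk> = \<zero>\<^bsub>L\<^esub>"
    and jacobi:
      "x \<in> carrier L \<Longrightarrow> y \<in> carrier L \<Longrightarrow> z \<in> carrier L \<Longrightarrow>
       \<lbrakk>x, \<lbrakk>y, z\<rbrakk>\<rbrakk> \<oplus>\<^bsub>L\<^esub> \<lbrakk>y, \<lbrakk>z, x\<rbrakk>\<rbrakk> \<oplus>\<^bsub>L\<^esub> \<lbrakk>z, \<lbrakk>x, y\<rbrakk>\<rbrakk> = \<zero>\<^bsub>L\<^esub>"

definition lie_hom ::
  "('k, 'x) ring_scheme \<Rightarrow> ('k, 'l, 'y) module_scheme \<Rightarrow> ('l \<Rightarrow> 'l \<Rightarrow> 'l) \<Rightarrow>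
     ('k, 'm, 'z) module_scheme \<Rightarrow> ('m \<Rightarrow> 'm \<Rightarrow> 'm) \<Rightarrow> ('l \<Rightarrow> 'm) set"
where
  "lie_hom K L bL M bM = {f \<in> mod_hom K L M.
     \<forall>x\<in>carrier L. \<forall>y\<in>carrier L. f (bL x y) = bM (f x) (f y)}"

locale lie_rinehart_algebra =
  fixes K :: "('k, 'x) ring_scheme"
    and R :: "('k, 'r, 'y) module_scheme"
    and L :: "('r, 'l, 'z) module_scheme"
    and bracket :: "'l \<Rightarrow> 'l \<Rightarrow> 'l" (\<open>\<lbrakk>_, _\<rbrakk>\<close>)
    and anchor :: "'l \<Rightarrow> 'r \<Rightarrow> 'r"
  assumes base_algebra: "algebra K R"
    and module: "module R L"
    and lie_algebra: "lie_algebra K (restrict_scalars R L) bracket"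
    and anchor_linear: "anchor \<in> mod_hom R L (Der K R)"
    and anchor_lie_hom:
      "anchor \<in> lie_hom K (restrict_scalars R L) bracket
                          (restrict_scalars R (Der K R)) (commutator R)"
    and leibniz:
      "r \<in> carrier R \<Longrightarrow> x \<in> carrier L \<Longrightarrow> y \<in> carrier L \<Longrightarrow>
       \<lbrakk>x, r \<odot>\<^bsub>L\<^esub> y\<rbrakk> = r \<odot>\<^bsub>L\<^esub> \<lbrakk>x, y\<rbrakk> \<oplus>\<^bsub>L\<^esub> anchor x r \<odot>\<^bsub>L\<^esub> y"

end

theory Submission
  imports Defs
begin

text \<open>
  Write \<open>D\<close> for the Lie derivative along \<open>X\<close>, and \<open>Y\<^sub>1 = [X, Y]\<close>, \<open>Y\<^sub>2 = [X, Y\<^sub>1]\<close>. The bracket is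
  the antisymmetrization \<open>[\<alpha>, \<beta>] = \<nabla>\<^sub>\<alpha> \<beta> - \<nabla>\<^sub>\<beta> \<alpha>\<close> of
  \<open>\<nabla>\<^sub>\<alpha> = \<langle>\<alpha>, Y\<rangle> D - \<langle>\<alpha>, Y\<^sub>1\<rangle>\<close>, which is a connection on the one-forms
  for the anchor \<open>\<rho>(\<alpha>) = \<langle>\<alpha>, Y\<rangle> X\<close>: it is \<open>R\<close>-linear in \<open>\<alpha>\<close>, and it satisfies
  the Leibniz rule in \<open>\<beta>\<close> because \<open>D\<close> is a first-order operator with symbol \<open>X\<close>.

  This connection is flat. Indeed \<open>D\<close> commutes with itself, so with \<open>a = \<langle>\<alpha>, Y\<rangle>\<close>,
  \<open>a\<^sub>1 = \<langle>\<alpha>, Y\<^sub>1\<rangle>\<close> and likewise for \<open>\<beta>\<close> the commutator of \<open>a D - a\<^sub>1\<close> and \<open>b D - b\<^sub>1\<close> is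
  \<open>(a X(b) - b X(a)) D - (a X(b\<^sub>1) - b X(a\<^sub>1))\<close>. It has to be compared with \<open>\<nabla>\<close> along
  \<open>[\<alpha>, \<beta>]\<close>. From \<open>\<langle>D \<beta>, Z\<rangle> = X \<langle>\<beta>, Z\<rangle> - \<langle>\<beta>, [X, Z]\<rangle>\<close> one finds
  \<open>\<langle>[\<alpha>, \<beta>], Y\<rangle> = a X(b) - b X(a)\<close> (lemma \<open>bracket_at_Y\<close>), while \<open>\<langle>[\<alpha>, \<beta>], Y\<^sub>1\<rangle>\<close> is
  \<open>a X(b\<^sub>1) - b X(a\<^sub>1)\<close> up to the error \<open>b \<langle>\<alpha>, Y\<^sub>2\<rangle> - a \<langle>\<beta>, Y\<^sub>2\<rangle>\<close>
  (lemma \<open>bracket_at_Y1\<close>). The symmetry hypothesis says exactly that this error vanishes, and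
  lemma \<open>conn_flat\<close> follows.

  The rest is a general principle (lemma \<open>lie_rinehart_algebra_if_flat_torsion_free\<close>): the
  torsion-free bracket of a flat connection satisfies the Jacobi identity, since each
  double bracket becomes a difference of two terms that telescope over the cyclic sum.
\<close>

section \<open>Modules of maps and restriction of scalars\<close>

lemma pointwise_module_simps [simp]:
  "carrier (pointwise_module R A F) = F"
  "zero (pointwise_module R A F) = (\<lambda>a\<in>A. \<zero>\<^bsub>R\<^esub>)"
  "ring.add (pointwise_module R A F) = (\<lambda>f g. \<lambda>a\<in>A. f a \<oplus>\<^bsub>R\<^esub> g a)"
  "smult (pointwise_module R A F) = (\<lambda>r f. \<lambda>a\<in>A. r \<otimes>\<^bsub>R\<^esub> f a)"
  by (simp_all add: pointwise_module_def)

lemma module_pointwise_module: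
  fixes R (structure)
  assumes "cring R"
    and F: "F \<subseteq> (A \<rightarrow> carrier R) \<inter> extensional A"
    and zero: "(\<lambda>a\<in>A. \<zero>) \<in> F"
    and add: "\<And>f g. f \<in> F \<Longrightarrow> g \<in> F \<Longrightarrow> (\<lambda>a\<in>A. f a \<oplus> g a) \<in> F"
    and smult: "\<And>r f. r \<in> carrier R \<Longrightarrow> f \<in> F \<Longrightarrow> (\<lambda>a\<in>A. r \<otimes> f a) \<in> F"
  shows "module R (pointwise_module R A F)"
proof -
  interpret cring R by fact
  have val: "f a \<in> carrier R" if "f \<in> F" "a \<in> A" for f a
    using F that by auto
  have ext: "f \<in> extensional A" if "f \<in> F" for f
    using F that by auto
  show ?thesis
  proof (rule moduleI)
    show "abelian_group (pointwise_module R A F)"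
    proof (rule abelian_groupI, goal_cases)
      case (6 f)
      have "(\<lambda>a\<in>A. \<ominus> \<one> \<otimes> f a) \<in> F"
        using 6 smult by simp
      moreover have "(\<lambda>a\<in>A. \<ominus> \<one> \<otimes> f a) \<oplus>\<^bsub>pointwise_module R A F\<^esub> f = \<zero>\<^bsub>pointwise_module R A F\<^esub>"
        using 6 by (auto simp: fun_eq_iff val l_minus l_neg)
      ultimately show ?case
        by (metis pointwise_module_simps(1))
    next
      case (5 f)
      then show ?case
        by (intro extensionalityI[of _ A]) (simp_all add: val ext)
    next
      case (3 f g h)
      then show ?case
        using val[of f] val[of g] val[of h] by (simp add: fun_eq_iff a_assoc)
    next
      case (4 f g)
      then show ?case
        using val[of f] val[of g] by (simp add: fun_eq_iff a_comm)
    qed (simp_all add: zero add)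
  next
    fix f assume "f \<in> carrier (pointwise_module R A F)"
    then show "\<one> \<odot>\<^bsub>pointwise_module R A F\<^esub> f = f"
      by (intro extensionalityI[of _ A]) (simp_all add: val ext)
  qed (use val in \<open>simp_all add: smult l_distr r_distr m_assoc is_cring fun_eq_iff\<close>)
qed

text \<open>
  Subtraction in a module is derived from its addition through inverses, so it is not pointwise by
  definition; it is determined by \<open>(f - g) + g = f\<close>, which can be evaluated at a point.
\<close>

lemma pointwise_minus:
  fixes R (structure)
  assumes "module R (pointwise_module R A F)" and F: "F \<subseteq> A \<rightarrow> carrier R"
    and "f \<in> F" "g \<in> F" "a \<in> A"
  shows "(f \<ominus>\<^bsub>pointwise_module R A F\<^esub> g) a = f a \<ominus> g a"
proof -
  let ?M = "pointwise_module R A F"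
  interpret M: module R ?M by fact
  have c: "f \<in> carrier ?M" "g \<in> carrier ?M"
    using assms by auto
  then have h: "f \<ominus>\<^bsub>?M\<^esub> g \<in> F"
    using M.M.minus_closed by fastforce
  have "(f \<ominus>\<^bsub>?M\<^esub> g) \<oplus>\<^bsub>?M\<^esub> g = f"
    using c by (simp add: M.M.minus_eq M.M.a_assoc M.M.l_neg del: pointwise_module_simps)
  then have "f a = (f \<ominus>\<^bsub>?M\<^esub> g) a \<oplus> g a"
    using \<open>a \<in> A\<close> by (auto dest: fun_cong[of _ _ a])
  moreover have "f a \<in> carrier R" "g a \<in> carrier R" "(f \<ominus>\<^bsub>?M\<^esub> g) a \<in> carrier R"
    using assms h by auto
  ultimately show ?thesis
    by (simp add: M.R.minus_eq M.R.a_assoc M.R.r_neg)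
qed

lemma restrict_scalars_simps [simp]:
  "carrier (restrict_scalars R M) = carrier M"
  "zero (restrict_scalars R M) = zero M"
  "ring.add (restrict_scalars R M) = ring.add M"
  "smult (restrict_scalars R M) = (\<lambda>k m. (k \<odot>\<^bsub>R\<^esub> \<one>\<^bsub>R\<^esub>) \<odot>\<^bsub>M\<^esub> m)"
  by (simp_all add: restrict_scalars_def)

lemma module_restrict_scalars:
  fixes R (structure)
  assumes "algebra K R" and "module R M"
  shows "module K (restrict_scalars R M)"
proof -
  interpret A: algebra K R by fact
  interpret M: module R M by fact
  interpret R: cring R by (rule A.M_cring)
  interpret K: cring K by (rule A.R_cring)
  have scalar: "k \<odot> \<one> \<in> carrier R" if "k \<in> carrier K" for k
    using that by simp
  have scalar_mult: "(k \<otimes>\<^bsub>K\<^esub> l) \<odot> \<one> = (k \<odot> \<one>) \<otimes> (l \<odot> \<one>)"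
    if "k \<in> carrier K" "l \<in> carrier K" for k l
    using that by (simp add: A.smult_assoc2 A.smult_assoc1)
  show ?thesis
  proof (rule moduleI)
    show "abelian_group (restrict_scalars R M)"
      by (rule abelian_groupI) (auto simp: M.M.a_ac intro: M.M.l_neg M.M.a_inv_closed)
  qed (auto simp: scalar scalar_mult A.smult_l_distr M.smult_l_distr M.smult_r_distr
      M.smult_assoc1 A.R_cring)
qed

section \<open>Identities in abelian groups and commutative rings\<close>

lemma additive_minus:
  assumes "abelian_group M" "abelian_group N" "f \<in> carrier M \<rightarrow> carrier N"
    and add: "\<And>x y. x \<in> carrier M \<Longrightarrow> y \<in> carrier M \<Longrightarrow> f (x \<oplus>\<^bsub>M\<^esub> y) = f x \<oplus>\<^bsub>N\<^esub> f y"
    and "x \<in> carrier M" "y \<in> carrier M"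
  shows "f (x \<ominus>\<^bsub>M\<^esub> y) = f x \<ominus>\<^bsub>N\<^esub> f y"
proof -
  interpret M: abelian_group M by fact
  interpret N: abelian_group N by fact
  have c: "f x \<in> carrier N" "f y \<in> carrier N" "f (x \<ominus>\<^bsub>M\<^esub> y) \<in> carrier N"
    using assms M.minus_closed[of x y] by auto
  have "(x \<ominus>\<^bsub>M\<^esub> y) \<oplus>\<^bsub>M\<^esub> y = x"
    using assms by (simp add: M.minus_eq M.a_assoc M.l_neg)
  then have "f x = f (x \<ominus>\<^bsub>M\<^esub> y) \<oplus>\<^bsub>N\<^esub> f y"
    using add[of "x \<ominus>\<^bsub>M\<^esub> y" y] assms(5,6) M.minus_closed[of x y] by simp
  then show ?thesis
    using c by (simp add: N.minus_eq N.a_assoc N.r_neg)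
qed

context abelian_group
begin

lemma diff_add_diff:
  assumes "a \<in> carrier G" "b \<in> carrier G" "c \<in> carrier G" "d \<in> carrier G"
  shows "(a \<oplus> b) \<ominus> (c \<oplus> d) = (a \<ominus> c) \<oplus> (b \<ominus> d)"
  using assms by (simp add: minus_eq minus_add a_ac)

lemma diff_diff_diff:
  assumes "a \<in> carrier G" "b \<in> carrier G" "c \<in> carrier G" "d \<in> carrier G"
  shows "(a \<ominus> b) \<ominus> (c \<ominus> d) = (a \<oplus> d) \<ominus> (b \<oplus> c)"
  using assms by (simp add: minus_eq minus_add a_ac)

lemma diff_diff_diff_add:
  assumes "a \<in> carrier G" "b \<in> carrier G" "c \<in> carrier G" "d \<in> carrier G"
  shows "(a \<ominus> c) \<ominus> (b \<ominus> d) = a \<ominus> b \<ominus> c \<oplus> d"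
  using assms by (simp add: minus_eq minus_add a_ac)

lemma diff_telescope:
  assumes "a \<in> carrier G" "b \<in> carrier G" "c \<in> carrier G"
  shows "(a \<ominus> b) \<oplus> (b \<ominus> c) \<oplus> (c \<ominus> a) = \<zero>"
proof -
  have "(a \<ominus> b) \<oplus> (b \<ominus> c) = a \<ominus> c"
    using assms by (simp add: minus_eq a_assoc r_neg1)
  moreover have "(a \<ominus> c) \<oplus> (c \<ominus> a) = \<zero>"
    using assms by (simp add: minus_eq a_assoc r_neg1 r_neg)
  ultimately show ?thesis
    by simp
qed

end

context cring
begin

text \<open>
  A decision procedure for ring identities with subtraction. The first six equations, used as rewrite
  rules, bring any expression built from \<open>\<oplus>\<close>, \<open>\<ominus>\<close> and \<open>\<otimes>\<close> into the form \<open>p \<ominus> n\<close> with \<open>p\<close> and \<open>n\<close> free of subtraction, and the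
  last two move \<open>n\<close> to the other side of an equation. What remains is an identity between
  sums of products, which distributivity and rewriting modulo associativity and commutativity decide:
  without inverses, there is nothing to cancel.
\<close>

lemma diff_normalize:
  assumes "x \<in> carrier R" "p \<in> carrier R" "n \<in> carrier R"
  shows "x \<oplus> (p \<ominus> n) = (x \<oplus> p) \<ominus> n" "(p \<ominus> n) \<oplus> x = (p \<oplus> x) \<ominus> n"
    and "x \<ominus> (p \<ominus> n) = (x \<oplus> n) \<ominus> p" "(p \<ominus> n) \<ominus> x = p \<ominus> (n \<oplus> x)"
    and "x \<otimes> (p \<ominus> n) = x \<otimes> p \<ominus> x \<otimes> n" "(p \<ominus> n) \<otimes> x = p \<otimes> x \<ominus> n \<otimes> x"
    and "p \<ominus> n = x \<longleftrightarrow> p = x \<oplus> n" "x = p \<ominus> n \<longleftrightarrow> x \<oplus> n = p"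
proof -
  show eq: "p \<ominus> n = x \<longleftrightarrow> p = x \<oplus> n"
    using assms by (auto simp: minus_eq a_assoc l_neg r_neg)
  show "x = p \<ominus> n \<longleftrightarrow> x \<oplus> n = p"
    using eq by auto
qed (use assms in \<open>simp_all add: minus_eq minus_add a_ac l_distr r_distr l_minus r_minus\<close>)

text \<open>
  In the remaining identities a letter prefixed by \<open>x\<close> or \<open>y\<close> stands for the image of an element under
  a derivation \<open>X\<close> or \<open>Y\<close>; it can be an arbitrary element, since only the ring structure enters once the
  product rule has been applied. In the identities about the connection, \<open>a\<close>, \<open>a1\<close>, \<open>a2\<close> and \<open>b\<close>,
  \<open>b1\<close>, \<open>b2\<close> are the values of \<open>\<alpha>\<close> and \<open>\<beta>\<close> at \<open>Y\<close>, \<open>[X, Y]\<close>, \<open>[X, [X, Y]]\<close>. The first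
  identity is the product rule for \<open>[X, Y]\<close>.
\<close>

lemma commutator_product_arith:
  assumes "a \<in> carrier R" "b \<in> carrier R" "xa \<in> carrier R" "xb \<in> carrier R" "ya \<in> carrier R"
    "yb \<in> carrier R" "xya \<in> carrier R" "xyb \<in> carrier R" "yxa \<in> carrier R" "yxb \<in> carrier R"
  shows "(xya \<otimes> b \<oplus> ya \<otimes> xb \<oplus> (xa \<otimes> yb \<oplus> a \<otimes> xyb))
      \<ominus> (yxa \<otimes> b \<oplus> xa \<otimes> yb \<oplus> (ya \<otimes> xb \<oplus> a \<otimes> yxb))
     = (xya \<ominus> yxa) \<otimes> b \<oplus> a \<otimes> (xyb \<ominus> yxb)"
  using assms by (simp add: diff_normalize l_distr r_distr a_ac m_ac)

text \<open>The commutator \<open>[a X, b X]\<close>, evaluated at \<open>r\<close>.\<close>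

lemma anchor_bracket_arith:
  assumes "a \<in> carrier R" "b \<in> carrier R" "xa \<in> carrier R" "xb \<in> carrier R"
    "xr \<in> carrier R" "xxr \<in> carrier R"
  shows "(a \<otimes> xb \<ominus> b \<otimes> xa) \<otimes> xr
     = a \<otimes> (xb \<otimes> xr \<oplus> b \<otimes> xxr) \<ominus> b \<otimes> (xa \<otimes> xr \<oplus> a \<otimes> xxr)"
  using assms by (simp add: diff_normalize l_distr r_distr a_ac m_ac)

text \<open>
  The curvature computation at a vector field \<open>Z\<close>, where \<open>s\<close>, \<open>q\<close>, \<open>p\<close> are the values of \<open>\<gamma>\<close> at
  \<open>Z\<close>, \<open>[X, Z]\<close>, \<open>[X, [X, Z]]\<close>. The second-order part \<open>D (D \<gamma>)\<close> has the value
  \<open>xxs - xq - (xq - p)\<close> and occurs with the factor \<open>a b\<close> on both sides of the outer difference.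
\<close>

lemma flatness_arith:
  assumes "a \<in> carrier R" "a1 \<in> carrier R" "b \<in> carrier R" "b1 \<in> carrier R"
    "xa \<in> carrier R" "xa1 \<in> carrier R" "xb \<in> carrier R" "xb1 \<in> carrier R"
    "s \<in> carrier R" "xs \<in> carrier R" "xxs \<in> carrier R"
    "q \<in> carrier R" "xq \<in> carrier R" "p \<in> carrier R"
  shows "(a \<otimes> ((xb \<otimes> (xs \<ominus> q) \<oplus> b \<otimes> (xxs \<ominus> xq)) \<ominus> (xb1 \<otimes> s \<oplus> b1 \<otimes> xs)
            \<ominus> (b \<otimes> (xq \<ominus> p) \<ominus> b1 \<otimes> q)) \<ominus> a1 \<otimes> (b \<otimes> (xs \<ominus> q) \<ominus> b1 \<otimes> s))
      \<ominus> (b \<otimes> ((xa \<otimes> (xs \<ominus> q) \<oplus> a \<otimes> (xxs \<ominus> xq)) \<ominus> (xa1 \<otimes> s \<oplus> a1 \<otimes> xs)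
            \<ominus> (a \<otimes> (xq \<ominus> p) \<ominus> a1 \<otimes> q)) \<ominus> b1 \<otimes> (a \<otimes> (xs \<ominus> q) \<ominus> a1 \<otimes> s))
     = (a \<otimes> xb \<ominus> b \<otimes> xa) \<otimes> (xs \<ominus> q) \<ominus> (a \<otimes> xb1 \<ominus> b \<otimes> xa1) \<otimes> s"
  using assms by (simp add: diff_normalize l_distr r_distr a_ac m_ac)

lemma bracket_at_Y_arith:
  assumes "a \<in> carrier R" "a1 \<in> carrier R" "b \<in> carrier R" "b1 \<in> carrier R"
    "xa \<in> carrier R" "xb \<in> carrier R"
  shows "(a \<otimes> (xb \<ominus> b1) \<ominus> a1 \<otimes> b) \<ominus> (b \<otimes> (xa \<ominus> a1) \<ominus> b1 \<otimes> a) = a \<otimes> xb \<ominus> b \<otimes> xa"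
   
  using assms by (simp add: diff_normalize l_distr r_distr a_ac m_ac)

lemma bracket_at_XY_arith:
  assumes "a \<in> carrier R" "a1 \<in> carrier R" "a2 \<in> carrier R"
    "b \<in> carrier R" "b1 \<in> carrier R" "b2 \<in> carrier R" "xa1 \<in> carrier R" "xb1 \<in> carrier R"
    and symmetric: "a \<otimes> b2 = b \<otimes> a2"
  shows "(a \<otimes> (xb1 \<ominus> b2) \<ominus> a1 \<otimes> b1) \<ominus> (b \<otimes> (xa1 \<ominus> a2) \<ominus> b1 \<otimes> a1) = a \<otimes> xb1 \<ominus> b \<otimes> xa1"
proof -
  have "a \<otimes> (xb1 \<ominus> b2) \<ominus> a1 \<otimes> b1 \<ominus> (b \<otimes> (xa1 \<ominus> a2) \<ominus> b1 \<otimes> a1)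
      = (a \<otimes> xb1 \<ominus> b \<otimes> xa1) \<oplus> (b \<otimes> a2 \<ominus> a \<otimes> b2)"
    using assms(1-8) by (simp add: diff_normalize l_distr r_distr a_ac m_ac)
  then show ?thesis
    using assms by (simp add: minus_eq r_neg)
qed

lemma connection_leibniz_arith:
  assumes "a \<in> carrier R" "a1 \<in> carrier R" "r \<in> carrier R" "xr \<in> carrier R"
    "s \<in> carrier R" "xs \<in> carrier R" "q \<in> carrier R"
  shows "a \<otimes> ((xr \<otimes> s \<oplus> r \<otimes> xs) \<ominus> r \<otimes> q) \<ominus> a1 \<otimes> (r \<otimes> s)
     = r \<otimes> (a \<otimes> (xs \<ominus> q) \<ominus> a1 \<otimes> s) \<oplus> (a \<otimes> xr) \<otimes> s"
  using assms by (simp add: diff_normalize l_distr r_distr a_ac m_ac)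

lemma connection_add_arith:
  assumes "a \<in> carrier R" "a1 \<in> carrier R" "b \<in> carrier R" "b1 \<in> carrier R"
    "t \<in> carrier R" "s \<in> carrier R"
  shows "(a \<oplus> b) \<otimes> t \<ominus> (a1 \<oplus> b1) \<otimes> s = (a \<otimes> t \<ominus> a1 \<otimes> s) \<oplus> (b \<otimes> t \<ominus> b1 \<otimes> s)"
  using assms by (simp add: l_distr diff_add_diff)

lemma connection_smult_arith:
  assumes "r \<in> carrier R" "a \<in> carrier R" "a1 \<in> carrier R" "t \<in> carrier R" "s \<in> carrier R"
  shows "(r \<otimes> a) \<otimes> t \<ominus> (r \<otimes> a1) \<otimes> s = r \<otimes> (a \<otimes> t \<ominus> a1 \<otimes> s)"
  using assms by (simp add: r_distr minus_eq r_minus m_assoc)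

lemma connection_add_right_arith:
  assumes "a \<in> carrier R" "a1 \<in> carrier R" "s \<in> carrier R" "s' \<in> carrier R"
    "xs \<in> carrier R" "xs' \<in> carrier R" "q \<in> carrier R" "q' \<in> carrier R"
  shows "a \<otimes> ((xs \<oplus> xs') \<ominus> (q \<oplus> q')) \<ominus> a1 \<otimes> (s \<oplus> s')
     = (a \<otimes> (xs \<ominus> q) \<ominus> a1 \<otimes> s) \<oplus> (a \<otimes> (xs' \<ominus> q') \<ominus> a1 \<otimes> s')"
  using assms by (simp add: diff_normalize l_distr r_distr a_ac m_ac)

end

section \<open>Derivations\<close>

locale commutative_algebra =
  fixes K :: "('k, 'x) ring_scheme" and R :: "('k, 'r, 'y) module_scheme" (structure)
  assumes algebra: "algebra K R"
begin

sublocale cring R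
  using algebra by (rule algebra.M_cring)

abbreviation T where "T \<equiv> carrier (Der K R)"

lemma T_eq: "T = derivations K R"
  by (simp add: Der_def)

lemma
  assumes "X \<in> T"
  shows T_closed [simp]: "a \<in> carrier R \<Longrightarrow> X a \<in> carrier R"
    and T_add: "a \<in> carrier R \<Longrightarrow> b \<in> carrier R \<Longrightarrow> X (a \<oplus> b) = X a \<oplus> X b"
    and T_smult: "k \<in> carrier K \<Longrightarrow> a \<in> carrier R \<Longrightarrow> X (k \<odot> a) = k \<odot> X a"
    and T_mult: "a \<in> carrier R \<Longrightarrow> b \<in> carrier R \<Longrightarrow> X (a \<otimes> b) = X a \<otimes> b \<oplus> a \<otimes> X b"
    and T_extensional: "X \<in> extensional (carrier R)"
  using assms unfolding T_eq derivations_def mod_hom_def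
  by (simp_all only: Pi_iff Int_iff mem_Collect_eq)

lemma derivationI:
  assumes "X \<in> extensional (carrier R)"
    and "\<And>a. a \<in> carrier R \<Longrightarrow> X a \<in> carrier R"
    and "\<And>a b. a \<in> carrier R \<Longrightarrow> b \<in> carrier R \<Longrightarrow> X (a \<oplus> b) = X a \<oplus> X b"
    and "\<And>k a. k \<in> carrier K \<Longrightarrow> a \<in> carrier R \<Longrightarrow> X (k \<odot> a) = k \<odot> X a"
    and "\<And>a b. a \<in> carrier R \<Longrightarrow> b \<in> carrier R \<Longrightarrow> X (a \<otimes> b) = X a \<otimes> b \<oplus> a \<otimes> X b"
  shows "X \<in> T"
  unfolding T_eq derivations_def mod_hom_def mem_Collect_eq Int_iff Pi_iff
  by (intro conjI ballI assms)

lemma T_minus: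
  assumes "X \<in> T" "a \<in> carrier R" "b \<in> carrier R"
  shows "X (a \<ominus> b) = X a \<ominus> X b"
  using assms by (intro additive_minus[OF is_abelian_group is_abelian_group]) (auto simp: T_add)

text \<open>
  Derivations kill constants. This is what makes a bracket with the Leibniz rule over \<open>R\<close> bilinear over
  \<open>K\<close>, whose action on an \<open>R\<close>-module goes through the elements \<open>k \<odot> \<one>\<close>.
\<close>

lemma T_scalar:
  assumes "X \<in> T" "k \<in> carrier K"
  shows "X (k \<odot> \<one>) = \<zero>"
proof -
  interpret A: algebra K R by (rule algebra)
  have "X \<one> = X \<one> \<oplus> X \<one>"
    using T_mult[OF assms(1), of \<one> \<one>] assms(1) by simp
  then have "X \<one> = \<zero>"
    using assms(1) by (metis T_closed add.l_cancel_one one_closed)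
  then show ?thesis
    using assms by (simp add: T_smult)
qed

lemma Der_add: "U \<oplus>\<^bsub>Der K R\<^esub> V = (\<lambda>a\<in>carrier R. U a \<oplus> V a)"
  by (simp add: Der_def)

lemma Der_smult: "r \<odot>\<^bsub>Der K R\<^esub> V = (\<lambda>a\<in>carrier R. r \<otimes> V a)"
  by (simp add: Der_def)

lemma T_add_closed [simp]:
  assumes "U \<in> T" "V \<in> T"
  shows "U \<oplus>\<^bsub>Der K R\<^esub> V \<in> T"
proof -
  interpret A: algebra K R by (rule algebra)
  show ?thesis
    unfolding Der_add using assms
    by (intro derivationI)
      (simp_all add: T_add[of U] T_add[of V] T_smult[of U] T_smult[of V] T_mult[of U] T_mult[of V]
        A.smult_r_distr a_ac l_distr r_distr)
qed

lemma T_smult_closed [simp]: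
  assumes "r \<in> carrier R" "V \<in> T"
  shows "r \<odot>\<^bsub>Der K R\<^esub> V \<in> T"
proof -
  interpret A: algebra K R by (rule algebra)
  have "r \<otimes> (k \<odot> a) = k \<odot> (r \<otimes> a)" if "k \<in> carrier K" "a \<in> carrier R" for k a
    using A.smult_assoc2[OF that assms(1)] m_comm[OF assms(1) A.smult_closed[OF that]]
      m_comm[OF assms(1) that(2)] by argo
  then show ?thesis
    unfolding Der_smult using assms
    by (intro derivationI)
      (simp_all add: T_add[of V] T_smult[of V] T_mult[of V] r_distr m_ac)
qed

lemma Der_add_apply: "a \<in> carrier R \<Longrightarrow> (U \<oplus>\<^bsub>Der K R\<^esub> V) a = U a \<oplus> V a"
  by (simp add: Der_add)

lemma Der_smult_apply: "a \<in> carrier R \<Longrightarrow> (r \<odot>\<^bsub>Der K R\<^esub> V) a = r \<otimes> V a"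
  by (simp add: Der_smult)

lemma Der_eqI:
  assumes "U \<in> T" "V \<in> T" "\<And>a. a \<in> carrier R \<Longrightarrow> U a = V a"
  shows "U = V"
  using T_extensional[OF assms(1)] T_extensional[OF assms(2)] assms(3) by (rule extensionalityI)

lemma commutator_apply: "a \<in> carrier R \<Longrightarrow> commutator R X Y a = X (Y a) \<ominus> Y (X a)"
  by (simp add: commutator_def)

lemma commutator_closed [simp]:
  assumes X: "X \<in> T" and Y: "Y \<in> T"
  shows "commutator R X Y \<in> T"
proof (rule derivationI)
  interpret A: algebra K R by (rule algebra)
  show "commutator R X Y (k \<odot> a) = k \<odot> commutator R X Y a"
    if "k \<in> carrier K" "a \<in> carrier R" for k a
    using that assms
    by (simp add: commutator_apply T_smult[of X] T_smult[of Y] minus_eq A.smult_r_distr A.smult_r_minus)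
  show "commutator R X Y (a \<oplus> b) = commutator R X Y a \<oplus> commutator R X Y b"
    if "a \<in> carrier R" "b \<in> carrier R" for a b
    using that assms by (simp add: commutator_apply T_add[OF X] T_add[OF Y] diff_add_diff)
  show "commutator R X Y (a \<otimes> b) = commutator R X Y a \<otimes> b \<oplus> a \<otimes> commutator R X Y b"
    if "a \<in> carrier R" "b \<in> carrier R" for a b
    using that assms
    by (simp add: commutator_apply T_add[OF X] T_add[OF Y] T_mult[OF X] T_mult[OF Y]
        commutator_product_arith)
qed (use assms in \<open>simp_all add: commutator_def\<close>)

end

section \<open>Flat torsion-free connections\<close>

context commutative_algebra
begin

text \<open>
  With \<open>P(x, y, z) = \<nabla>\<^sub>x \<nabla>\<^sub>y z + \<nabla>\<^sub>z \<nabla>\<^sub>y x\<close>, flatness turns \<open>[x, [y, z]] = \<nabla>\<^sub>x [y, z] - \<nabla>\<^bsub>[y, z]\<^esub> x\<close>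
  into \<open>P(x, y, z) - P(y, z, x)\<close>, and the cyclic sum of these differences telescopes to zero.
  In other words, \<open>x, y \<mapsto> \<nabla>\<^sub>x y\<close> is a left-symmetric product, and the bracket is its commutator.
\<close>

lemma lie_rinehart_algebra_if_flat_torsion_free:
  fixes L :: "('r, 'l, 'z) module_scheme"
  assumes "module R L"
    and closed: "\<And>x y. x \<in> carrier L \<Longrightarrow> y \<in> carrier L \<Longrightarrow> conn x y \<in> carrier L"
    and add_left: "\<And>x y z. x \<in> carrier L \<Longrightarrow> y \<in> carrier L \<Longrightarrow> z \<in> carrier L \<Longrightarrow>
      conn (x \<oplus>\<^bsub>L\<^esub> y) z = conn x z \<oplus>\<^bsub>L\<^esub> conn y z"
    and add_right: "\<And>x y z. x \<in> carrier L \<Longrightarrow> y \<in> carrier L \<Longrightarrow> z \<in> carrier L \<Longrightarrow>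
      conn x (y \<oplus>\<^bsub>L\<^esub> z) = conn x y \<oplus>\<^bsub>L\<^esub> conn x z"
    and smult_left: "\<And>r x y. r \<in> carrier R \<Longrightarrow> x \<in> carrier L \<Longrightarrow> y \<in> carrier L \<Longrightarrow>
      conn (r \<odot>\<^bsub>L\<^esub> x) y = r \<odot>\<^bsub>L\<^esub> conn x y"
    and leibniz: "\<And>r x y. r \<in> carrier R \<Longrightarrow> x \<in> carrier L \<Longrightarrow> y \<in> carrier L \<Longrightarrow>
      conn x (r \<odot>\<^bsub>L\<^esub> y) = r \<odot>\<^bsub>L\<^esub> conn x y \<oplus>\<^bsub>L\<^esub> anchor x r \<odot>\<^bsub>L\<^esub> y"
    and torsion_free: "\<And>x y. x \<in> carrier L \<Longrightarrow> y \<in> carrier L \<Longrightarrow>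
      bracket x y = conn x y \<ominus>\<^bsub>L\<^esub> conn y x"
    and flat: "\<And>x y z. x \<in> carrier L \<Longrightarrow> y \<in> carrier L \<Longrightarrow> z \<in> carrier L \<Longrightarrow>
      conn x (conn y z) \<ominus>\<^bsub>L\<^esub> conn y (conn x z) = conn (bracket x y) z"
    and anchor: "anchor \<in> mod_hom R L (Der K R)"
    and anchor_bracket: "\<And>x y. x \<in> carrier L \<Longrightarrow> y \<in> carrier L \<Longrightarrow>
      anchor (bracket x y) = commutator R (anchor x) (anchor y)"
  shows "lie_rinehart_algebra K R L bracket anchor"
proof -
  interpret L: module R L by fact
  interpret A: algebra K R by (rule algebra)
  have anchor_closed: "anchor x \<in> T" if "x \<in> carrier L" for x
    using anchor that by (auto simp: mod_hom_def)
  have anchor_val: "anchor x r \<in> carrier R" if "x \<in> carrier L" "r \<in> carrier R" for x r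
    using anchor_closed that by simp
  have bracket_closed: "bracket x y \<in> carrier L" if "x \<in> carrier L" "y \<in> carrier L" for x y
    using that by (simp add: torsion_free closed)
  have conn_minus: "conn x (y \<ominus>\<^bsub>L\<^esub> z) = conn x y \<ominus>\<^bsub>L\<^esub> conn x z"
    if "x \<in> carrier L" "y \<in> carrier L" "z \<in> carrier L" for x y z
    using that
    by (intro additive_minus[OF L.M.abelian_group_axioms L.M.abelian_group_axioms])
      (simp_all add: closed add_right)
  have smult_minus: "r \<odot>\<^bsub>L\<^esub> (x \<ominus>\<^bsub>L\<^esub> y) = r \<odot>\<^bsub>L\<^esub> x \<ominus>\<^bsub>L\<^esub> r \<odot>\<^bsub>L\<^esub> y"
    if "r \<in> carrier R" "x \<in> carrier L" "y \<in> carrier L" for r x y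
    using that by (simp add: L.M.minus_eq L.smult_r_distr L.smult_r_minus)
  have bracket_leibniz:
    "bracket x (r \<odot>\<^bsub>L\<^esub> y) = r \<odot>\<^bsub>L\<^esub> bracket x y \<oplus>\<^bsub>L\<^esub> anchor x r \<odot>\<^bsub>L\<^esub> y"
    if "r \<in> carrier R" "x \<in> carrier L" "y \<in> carrier L" for r x y
    using that
    by (simp add: torsion_free leibniz smult_left smult_minus closed anchor_val)
      (simp add: closed anchor_val L.M.minus_eq L.M.a_ac)
  have scalar: "k \<odot> \<one> \<in> carrier R" "anchor x (k \<odot> \<one>) = \<zero>"
    if "k \<in> carrier K" "x \<in> carrier L" for k x
    using that T_scalar anchor_closed by simp_all
  have smult_right: "bracket x ((k \<odot> \<one>) \<odot>\<^bsub>L\<^esub> y) = (k \<odot> \<one>) \<odot>\<^bsub>L\<^esub> bracket x y"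
    if "k \<in> carrier K" "x \<in> carrier L" "y \<in> carrier L" for k x y
    using that by (simp add: bracket_leibniz scalar bracket_closed)
  have smult_left': "bracket ((k \<odot> \<one>) \<odot>\<^bsub>L\<^esub> x) y = (k \<odot> \<one>) \<odot>\<^bsub>L\<^esub> bracket x y"
    if "k \<in> carrier K" "x \<in> carrier L" "y \<in> carrier L" for k x y
    using that
    by (simp add: torsion_free smult_left leibniz scalar closed smult_minus)
  have double_bracket: "bracket x (bracket y z) =
      (conn x (conn y z) \<oplus>\<^bsub>L\<^esub> conn z (conn y x)) \<ominus>\<^bsub>L\<^esub> (conn x (conn z y) \<oplus>\<^bsub>L\<^esub> conn y (conn z x))"
    if "x \<in> carrier L" "y \<in> carrier L" "z \<in> carrier L" for x y z
  proof -
    have "bracket x (bracket y z) = conn x (bracket y z) \<ominus>\<^bsub>L\<^esub> conn (bracket y z) x"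
      using that bracket_closed by (intro torsion_free)
    also have "conn x (bracket y z) = conn x (conn y z) \<ominus>\<^bsub>L\<^esub> conn x (conn z y)"
      using that by (simp add: torsion_free closed conn_minus)
    also have "conn (bracket y z) x = conn y (conn z x) \<ominus>\<^bsub>L\<^esub> conn z (conn y x)"
      using that by (simp add: flat)
    finally show ?thesis
      using that by (simp add: closed L.M.diff_diff_diff)
  qed
  have jacobi: "bracket x (bracket y z) \<oplus>\<^bsub>L\<^esub> bracket y (bracket z x) \<oplus>\<^bsub>L\<^esub> bracket z (bracket x y)
      = \<zero>\<^bsub>L\<^esub>"
    if "x \<in> carrier L" "y \<in> carrier L" "z \<in> carrier L" for x y z
  proof -
    define P where "P x y z = conn x (conn y z) \<oplus>\<^bsub>L\<^esub> conn z (conn y x)" for x y z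
    have P: "P x y z \<in> carrier L" if "x \<in> carrier L" "y \<in> carrier L" "z \<in> carrier L" for x y z
      using that by (simp add: P_def closed)
    have bb: "bracket x (bracket y z) = P x y z \<ominus>\<^bsub>L\<^esub> P y z x"
      if "x \<in> carrier L" "y \<in> carrier L" "z \<in> carrier L" for x y z
      using that by (simp add: double_bracket P_def closed L.M.a_comm)
    show ?thesis
      using that by (simp add: bb P L.M.diff_telescope)
  qed
  have "lie_algebra K (restrict_scalars R L) bracket"
  proof (rule lie_algebra.intro[OF module_restrict_scalars[OF algebra assms(1)]],
      rule lie_algebra_axioms.intro, goal_cases)
    case (2 x y z)
    then show ?case
      by (simp add: torsion_free add_left add_right closed L.M.diff_add_diff)
  next
    case (3 x y z)
    then show ?case
      by (simp add: torsion_free add_left add_right closed L.M.diff_add_diff)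
  next
    case (6 x)
    then show ?case
      by (simp add: torsion_free closed L.M.minus_eq L.M.r_neg)
  qed (simp_all add: bracket_closed smult_right smult_left' jacobi)
  moreover have "anchor \<in> lie_hom K (restrict_scalars R L) bracket
      (restrict_scalars R (Der K R)) (commutator R)"
    using anchor scalar(1) by (auto simp: lie_hom_def mod_hom_def anchor_bracket)
  ultimately show ?thesis
    by (intro lie_rinehart_algebra.intro) (use assms(1) algebra anchor bracket_leibniz in simp_all)
qed

end

section \<open>One-forms and the Lie derivative\<close>

context commutative_algebra
begin

abbreviation Omega where "Omega \<equiv> carrier (Omega1 K R)"

lemma Omega_eq:
  "Omega = mod_hom R (Der K R) (regular_module R) \<inter> extensional T"
  by (simp add: Omega1_def)

lemma
  assumes "\<alpha> \<in> Omega"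
  shows Omega_closed [simp]: "Z \<in> T \<Longrightarrow> \<alpha> Z \<in> carrier R"
    and Omega_add: "Z \<in> T \<Longrightarrow> W \<in> T \<Longrightarrow> \<alpha> (Z \<oplus>\<^bsub>Der K R\<^esub> W) = \<alpha> Z \<oplus> \<alpha> W"
    and Omega_smult: "r \<in> carrier R \<Longrightarrow> Z \<in> T \<Longrightarrow> \<alpha> (r \<odot>\<^bsub>Der K R\<^esub> Z) = r \<otimes> \<alpha> Z"
    and Omega_extensional: "\<alpha> \<in> extensional T"
  using assms unfolding Omega_eq mod_hom_def regular_module_def
  by (simp_all only: Pi_iff Int_iff mem_Collect_eq partial_object.simps ring_record_simps module.simps)

lemma OmegaI:
  assumes "\<alpha> \<in> extensional T" "\<And>Z. Z \<in> T \<Longrightarrow> \<alpha> Z \<in> carrier R"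
    and "\<And>Z W. Z \<in> T \<Longrightarrow> W \<in> T \<Longrightarrow> \<alpha> (Z \<oplus>\<^bsub>Der K R\<^esub> W) = \<alpha> Z \<oplus> \<alpha> W"
    and "\<And>r Z. r \<in> carrier R \<Longrightarrow> Z \<in> T \<Longrightarrow> \<alpha> (r \<odot>\<^bsub>Der K R\<^esub> Z) = r \<otimes> \<alpha> Z"
  shows "\<alpha> \<in> Omega"
  unfolding Omega_eq mod_hom_def regular_module_def mem_Collect_eq Int_iff Pi_iff
    partial_object.simps ring_record_simps module.simps
  by (intro conjI ballI assms)

lemma Omega_eqI:
  assumes "\<alpha> \<in> Omega" "\<beta> \<in> Omega" "\<And>Z. Z \<in> T \<Longrightarrow> \<alpha> Z = \<beta> Z"
  shows "\<alpha> = \<beta>"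
  using Omega_extensional[OF assms(1)] Omega_extensional[OF assms(2)] assms(3)
  by (rule extensionalityI)

lemma module_Omega1: "module R (Omega1 K R)"
  unfolding Omega1_def
proof (rule module_pointwise_module[OF is_cring], goal_cases)
  case 1
  show ?case
    unfolding Omega_eq[symmetric] using Omega_closed Omega_extensional by blast
next
  case 2
  show ?case
    unfolding Omega_eq[symmetric] by (rule OmegaI) simp_all
next
  case (3 f g)
  then have f: "f \<in> Omega" and g: "g \<in> Omega"
    unfolding Omega_eq by blast+
  show ?case
    unfolding Omega_eq[symmetric]
    by (rule OmegaI)
      (simp_all add: f g Omega_add[OF f] Omega_add[OF g] Omega_smult[OF f] Omega_smult[OF g] a_ac r_distr)
next
  case (4 r f)
  then have f: "f \<in> Omega" and r: "r \<in> carrier R"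
    unfolding Omega_eq by blast+
  show ?case
    unfolding Omega_eq[symmetric]
    by (rule OmegaI) (simp_all add: f r Omega_add[OF f] Omega_smult[OF f] r_distr m_ac)
qed

lemma Omega_add_apply: "Z \<in> T \<Longrightarrow> (\<alpha> \<oplus>\<^bsub>Omega1 K R\<^esub> \<beta>) Z = \<alpha> Z \<oplus> \<beta> Z"
  by (simp add: Omega1_def)

lemma Omega_smult_apply: "Z \<in> T \<Longrightarrow> (r \<odot>\<^bsub>Omega1 K R\<^esub> \<alpha>) Z = r \<otimes> \<alpha> Z"
  by (simp add: Omega1_def)

lemma Omega_minus_apply:
  assumes "\<alpha> \<in> Omega" "\<beta> \<in> Omega" "Z \<in> T"
  shows "(\<alpha> \<ominus>\<^bsub>Omega1 K R\<^esub> \<beta>) Z = \<alpha> Z \<ominus> \<beta> Z"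
  unfolding Omega1_def
proof (rule pointwise_minus)
  show "module R (pointwise_module R T (mod_hom R (Der K R) (regular_module R) \<inter> extensional T))"
    using module_Omega1 unfolding Omega1_def .
  show "mod_hom R (Der K R) (regular_module R) \<inter> extensional T \<subseteq> T \<rightarrow> carrier R"
    unfolding Omega_eq[symmetric] using Omega_closed by blast
qed (use assms in \<open>simp_all add: Omega_eq\<close>)

lemma commutator_add_right:
  assumes X: "X \<in> T" and "Z \<in> T" "W \<in> T"
  shows "commutator R X (Z \<oplus>\<^bsub>Der K R\<^esub> W) = commutator R X Z \<oplus>\<^bsub>Der K R\<^esub> commutator R X W"
  using assms
  by (intro Der_eqI) (simp_all add: commutator_apply Der_add_apply T_add[OF X] diff_add_diff)

text \<open>
  The term \<open>X(r) Z\<close> is what cancels against \<open>X(r) \<langle>\<alpha>, Z\<rangle>\<close> from the product rule, so that the Lie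
  derivative of an \<open>R\<close>-linear form is again \<open>R\<close>-linear.
\<close>

lemma commutator_smult_right:
  assumes X: "X \<in> T" and "Z \<in> T" "r \<in> carrier R"
  shows "commutator R X (r \<odot>\<^bsub>Der K R\<^esub> Z) =
    X r \<odot>\<^bsub>Der K R\<^esub> Z \<oplus>\<^bsub>Der K R\<^esub> r \<odot>\<^bsub>Der K R\<^esub> commutator R X Z"
  using assms
  by (intro Der_eqI)
    (simp_all add: commutator_apply Der_add_apply Der_smult_apply T_mult[OF X] minus_eq r_distr r_minus a_assoc)

lemma lie_derivative_apply:
  "Z \<in> T \<Longrightarrow> lie_derivative K R X \<alpha> Z = X (\<alpha> Z) \<ominus> \<alpha> (commutator R X Z)"
  by (simp add: lie_derivative_def)

lemma lie_derivative_closed [simp]: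
  assumes X: "X \<in> T" and \<alpha>: "\<alpha> \<in> Omega"
  shows "lie_derivative K R X \<alpha> \<in> Omega"
proof (rule OmegaI)
  show "lie_derivative K R X \<alpha> (Z \<oplus>\<^bsub>Der K R\<^esub> W) = lie_derivative K R X \<alpha> Z \<oplus> lie_derivative K R X \<alpha> W"
    if "Z \<in> T" "W \<in> T" for Z W
    using that assms
    by (simp add: lie_derivative_apply commutator_add_right Omega_add[OF \<alpha>] T_add[OF X] diff_add_diff)
  show "lie_derivative K R X \<alpha> (r \<odot>\<^bsub>Der K R\<^esub> Z) = r \<otimes> lie_derivative K R X \<alpha> Z"
    if "r \<in> carrier R" "Z \<in> T" for r Z
  proof -
    have "lie_derivative K R X \<alpha> (r \<odot>\<^bsub>Der K R\<^esub> Z) =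
        (X r \<otimes> \<alpha> Z \<oplus> r \<otimes> X (\<alpha> Z)) \<ominus> (X r \<otimes> \<alpha> Z \<oplus> r \<otimes> \<alpha> (commutator R X Z))"
      using that assms
      by (simp add: lie_derivative_apply commutator_smult_right Omega_add[OF \<alpha>] Omega_smult[OF \<alpha>]
          T_mult[OF X])
    also have "\<dots> = r \<otimes> X (\<alpha> Z) \<ominus> r \<otimes> \<alpha> (commutator R X Z)"
      using that assms by (simp add: diff_add_diff) (simp add: minus_eq r_neg)
    also have "\<dots> = r \<otimes> lie_derivative K R X \<alpha> Z"
      using that assms by (simp add: lie_derivative_apply minus_eq r_distr r_minus)
    finally show ?thesis .
  qed
qed (use assms in \<open>simp_all add: lie_derivative_def\<close>)

end

section \<open>The connection along a pair of derivations\<close>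

locale derivation_pair = commutative_algebra K R
  for K :: "('k, 'x) ring_scheme" and R :: "('k, 'r, 'y) module_scheme" (structure) +
  fixes X Y :: "'r \<Rightarrow> 'r"
  assumes X [simp]: "X \<in> T" and Y [simp]: "Y \<in> T"
begin

abbreviation Y1 where "Y1 \<equiv> commutator R X Y"
abbreviation Y2 where "Y2 \<equiv> commutator R X Y1"
abbreviation D where "D \<equiv> lie_derivative K R X"

definition conn where
  "conn \<alpha> \<beta> = \<alpha> Y \<odot>\<^bsub>Omega1 K R\<^esub> D \<beta> \<ominus>\<^bsub>Omega1 K R\<^esub> \<alpha> Y1 \<odot>\<^bsub>Omega1 K R\<^esub> \<beta>"

definition bracket where
  "bracket \<alpha> \<beta> = conn \<alpha> \<beta> \<ominus>\<^bsub>Omega1 K R\<^esub> conn \<beta> \<alpha>"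

sublocale Om: module R "Omega1 K R"
  by (rule module_Omega1)

lemma conn_closed [simp]: "\<alpha> \<in> Omega \<Longrightarrow> \<beta> \<in> Omega \<Longrightarrow> conn \<alpha> \<beta> \<in> Omega"
  by (simp add: conn_def)

lemma bracket_closed [simp]: "\<alpha> \<in> Omega \<Longrightarrow> \<beta> \<in> Omega \<Longrightarrow> bracket \<alpha> \<beta> \<in> Omega"
  by (simp add: bracket_def)

lemma conn_apply:
  assumes "\<alpha> \<in> Omega" "\<beta> \<in> Omega" "Z \<in> T"
  shows "conn \<alpha> \<beta> Z = \<alpha> Y \<otimes> (X (\<beta> Z) \<ominus> \<beta> (commutator R X Z)) \<ominus> \<alpha> Y1 \<otimes> \<beta> Z"
  using assms
  by (simp add: conn_def Omega_minus_apply Omega_smult_apply lie_derivative_apply)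

lemma bracket_apply:
  assumes "\<alpha> \<in> Omega" "\<beta> \<in> Omega" "Z \<in> T"
  shows "bracket \<alpha> \<beta> Z = conn \<alpha> \<beta> Z \<ominus> conn \<beta> \<alpha> Z"
  using assms by (simp add: bracket_def Omega_minus_apply)

lemma bracket_eq:
  assumes "\<alpha> \<in> Omega" "\<beta> \<in> Omega"
  shows "bracket \<alpha> \<beta> =
    \<alpha> Y \<odot>\<^bsub>Omega1 K R\<^esub> D \<beta> \<ominus>\<^bsub>Omega1 K R\<^esub> \<beta> Y \<odot>\<^bsub>Omega1 K R\<^esub> D \<alpha>
    \<ominus>\<^bsub>Omega1 K R\<^esub> \<alpha> Y1 \<odot>\<^bsub>Omega1 K R\<^esub> \<beta> \<oplus>\<^bsub>Omega1 K R\<^esub> \<beta> Y1 \<odot>\<^bsub>Omega1 K R\<^esub> \<alpha>"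
  using assms by (simp add: bracket_def conn_def Om.M.diff_diff_diff_add)

lemma conn_add_left:
  assumes "\<alpha> \<in> Omega" "\<beta> \<in> Omega" "\<gamma> \<in> Omega"
  shows "conn (\<alpha> \<oplus>\<^bsub>Omega1 K R\<^esub> \<beta>) \<gamma> = conn \<alpha> \<gamma> \<oplus>\<^bsub>Omega1 K R\<^esub> conn \<beta> \<gamma>"
  using assms
  by (intro Omega_eqI) (simp_all add: conn_apply Omega_add_apply connection_add_arith)

lemma conn_smult_left:
  assumes "r \<in> carrier R" "\<alpha> \<in> Omega" "\<beta> \<in> Omega"
  shows "conn (r \<odot>\<^bsub>Omega1 K R\<^esub> \<alpha>) \<beta> = r \<odot>\<^bsub>Omega1 K R\<^esub> conn \<alpha> \<beta>"
  using assms
  by (intro Omega_eqI) (simp_all add: conn_apply Omega_smult_apply connection_smult_arith)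

lemma conn_add_right:
  assumes "\<alpha> \<in> Omega" "\<beta> \<in> Omega" "\<gamma> \<in> Omega"
  shows "conn \<alpha> (\<beta> \<oplus>\<^bsub>Omega1 K R\<^esub> \<gamma>) = conn \<alpha> \<beta> \<oplus>\<^bsub>Omega1 K R\<^esub> conn \<alpha> \<gamma>"
  using assms
  by (intro Omega_eqI)
    (simp_all add: conn_apply Omega_add_apply T_add[OF X] connection_add_right_arith)

lemma conn_leibniz:
  assumes "r \<in> carrier R" "\<alpha> \<in> Omega" "\<beta> \<in> Omega"
  shows "conn \<alpha> (r \<odot>\<^bsub>Omega1 K R\<^esub> \<beta>) = r \<odot>\<^bsub>Omega1 K R\<^esub> conn \<alpha> \<beta>
    \<oplus>\<^bsub>Omega1 K R\<^esub> (\<alpha> Y \<odot>\<^bsub>Der K R\<^esub> X) r \<odot>\<^bsub>Omega1 K R\<^esub> \<beta>"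
  using assms
  by (intro Omega_eqI)
    (simp_all add: conn_apply Omega_smult_apply Omega_add_apply T_mult[OF X] Der_smult
      connection_leibniz_arith)

text \<open>
  The pairing with \<open>Y\<close> is where the correction terms of the bracket are needed: those containing
  \<open>[X, Y]\<close> cancel the ones that the Lie derivative produces.
\<close>

lemma bracket_at_Y:
  assumes "\<alpha> \<in> Omega" "\<beta> \<in> Omega"
  shows "bracket \<alpha> \<beta> Y = \<alpha> Y \<otimes> X (\<beta> Y) \<ominus> \<beta> Y \<otimes> X (\<alpha> Y)"
  using assms by (simp add: bracket_apply conn_apply bracket_at_Y_arith)

text \<open>
  Here the products \<open>\<langle>\<alpha>, [X, Y]\<rangle> \<langle>\<beta>, [X, Y]\<rangle>\<close> cancel, and the terms in \<open>[X, [X, Y]]\<close> that the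
  Lie derivative produces are left over; their difference, which the last premise makes vanish, is the obstruction to flatness.
\<close>

lemma bracket_at_Y1:
  assumes "\<alpha> \<in> Omega" "\<beta> \<in> Omega" and "\<alpha> Y \<otimes> \<beta> Y2 = \<beta> Y \<otimes> \<alpha> Y2"
  shows "bracket \<alpha> \<beta> Y1 = \<alpha> Y \<otimes> X (\<beta> Y1) \<ominus> \<beta> Y \<otimes> X (\<alpha> Y1)"
proof -
  have "bracket \<alpha> \<beta> Y1 = (\<alpha> Y \<otimes> (X (\<beta> Y1) \<ominus> \<beta> Y2) \<ominus> \<alpha> Y1 \<otimes> \<beta> Y1)
      \<ominus> (\<beta> Y \<otimes> (X (\<alpha> Y1) \<ominus> \<alpha> Y2) \<ominus> \<beta> Y1 \<otimes> \<alpha> Y1)"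
    using assms(1,2) by (simp add: bracket_apply conn_apply)
  also have "\<dots> = \<alpha> Y \<otimes> X (\<beta> Y1) \<ominus> \<beta> Y \<otimes> X (\<alpha> Y1)"
    by (rule bracket_at_XY_arith) (use assms in simp_all)
  finally show ?thesis .
qed

text \<open>
  The two pairings computed above are exactly the coefficients of \<open>D \<gamma>\<close> and \<open>\<gamma>\<close> in the
  commutator of the operators \<open>conn \<alpha>\<close> and \<open>conn \<beta>\<close>.
\<close>

lemma conn_flat:
  assumes "\<alpha> \<in> Omega" "\<beta> \<in> Omega" "\<gamma> \<in> Omega" and "\<alpha> Y \<otimes> \<beta> Y2 = \<beta> Y \<otimes> \<alpha> Y2"
  shows "conn \<alpha> (conn \<beta> \<gamma>) \<ominus>\<^bsub>Omega1 K R\<^esub> conn \<beta> (conn \<alpha> \<gamma>) = conn (bracket \<alpha> \<beta>) \<gamma>"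
proof (rule Omega_eqI)
  fix Z assume Z: "Z \<in> T"
  have conn_conn: "conn \<alpha> (conn \<beta> \<gamma>) Z = \<alpha> Y \<otimes>
      ((X (\<beta> Y) \<otimes> (X (\<gamma> Z) \<ominus> \<gamma> (commutator R X Z))
          \<oplus> \<beta> Y \<otimes> (X (X (\<gamma> Z)) \<ominus> X (\<gamma> (commutator R X Z))))
        \<ominus> (X (\<beta> Y1) \<otimes> \<gamma> Z \<oplus> \<beta> Y1 \<otimes> X (\<gamma> Z))
        \<ominus> (\<beta> Y \<otimes> (X (\<gamma> (commutator R X Z)) \<ominus> \<gamma> (commutator R X (commutator R X Z)))
            \<ominus> \<beta> Y1 \<otimes> \<gamma> (commutator R X Z)))
      \<ominus> \<alpha> Y1 \<otimes> (\<beta> Y \<otimes> (X (\<gamma> Z) \<ominus> \<gamma> (commutator R X Z)) \<ominus> \<beta> Y1 \<otimes> \<gamma> Z)"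
    if "\<alpha> \<in> Omega" "\<beta> \<in> Omega" for \<alpha> \<beta>
    using that assms(3) Z by (simp add: conn_apply T_minus[OF X] T_mult[OF X])
  have "(conn \<alpha> (conn \<beta> \<gamma>) \<ominus>\<^bsub>Omega1 K R\<^esub> conn \<beta> (conn \<alpha> \<gamma>)) Z
      = conn \<alpha> (conn \<beta> \<gamma>) Z \<ominus> conn \<beta> (conn \<alpha> \<gamma>) Z"
    using assms Z by (simp add: Omega_minus_apply)
  also have "\<dots> = (\<alpha> Y \<otimes> X (\<beta> Y) \<ominus> \<beta> Y \<otimes> X (\<alpha> Y)) \<otimes> (X (\<gamma> Z) \<ominus> \<gamma> (commutator R X Z))
      \<ominus> (\<alpha> Y \<otimes> X (\<beta> Y1) \<ominus> \<beta> Y \<otimes> X (\<alpha> Y1)) \<otimes> \<gamma> Z"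
    unfolding conn_conn[OF assms(1,2)] conn_conn[OF assms(2,1)]
    by (rule flatness_arith) (use assms(1-3) Z in simp_all)
  also have "\<dots> = conn (bracket \<alpha> \<beta>) \<gamma> Z"
    using assms Z by (simp add: conn_apply[of "bracket \<alpha> \<beta>"] bracket_at_Y bracket_at_Y1)
  finally show "(conn \<alpha> (conn \<beta> \<gamma>) \<ominus>\<^bsub>Omega1 K R\<^esub> conn \<beta> (conn \<alpha> \<gamma>)) Z = conn (bracket \<alpha> \<beta>) \<gamma> Z" .
qed (use assms in simp_all)

lemma anchor_mod_hom: "(\<lambda>\<alpha>. \<alpha> Y \<odot>\<^bsub>Der K R\<^esub> X) \<in> mod_hom R (Omega1 K R) (Der K R)"
proof -
  have "(\<alpha> \<oplus>\<^bsub>Omega1 K R\<^esub> \<beta>) Y \<odot>\<^bsub>Der K R\<^esub> X = \<alpha> Y \<odot>\<^bsub>Der K R\<^esub> X \<oplus>\<^bsub>Der K R\<^esub> \<beta> Y \<odot>\<^bsub>Der K R\<^esub> X"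
    if "\<alpha> \<in> Omega" "\<beta> \<in> Omega" for \<alpha> \<beta>
    using that by (intro Der_eqI) (simp_all add: Omega_add_apply Der_add_apply Der_smult_apply l_distr)
  moreover have "(r \<odot>\<^bsub>Omega1 K R\<^esub> \<alpha>) Y \<odot>\<^bsub>Der K R\<^esub> X = r \<odot>\<^bsub>Der K R\<^esub> (\<alpha> Y \<odot>\<^bsub>Der K R\<^esub> X)"
    if "r \<in> carrier R" "\<alpha> \<in> Omega" for r \<alpha>
    using that by (intro Der_eqI) (simp_all add: Omega_smult_apply Der_smult_apply m_assoc)
  ultimately show ?thesis
    by (simp add: mod_hom_def)
qed

lemma anchor_bracket:
  assumes "\<alpha> \<in> Omega" "\<beta> \<in> Omega"
  shows "bracket \<alpha> \<beta> Y \<odot>\<^bsub>Der K R\<^esub> X = commutator R (\<alpha> Y \<odot>\<^bsub>Der K R\<^esub> X) (\<beta> Y \<odot>\<^bsub>Der K R\<^esub> X)"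
proof (rule Der_eqI)
  show "(bracket \<alpha> \<beta> Y \<odot>\<^bsub>Der K R\<^esub> X) r = commutator R (\<alpha> Y \<odot>\<^bsub>Der K R\<^esub> X) (\<beta> Y \<odot>\<^bsub>Der K R\<^esub> X) r"
    if "r \<in> carrier R" for r
    using that assms
    by (simp add: commutator_apply Der_smult_apply bracket_at_Y T_mult[OF X] anchor_bracket_arith[where xxr = "X (X r)"])
qed (use assms in simp_all)

text \<open>
  The bracket is only required to agree with that of the connection on one-forms: two expressions for it
  may differ at arguments outside the carrier.
\<close>

lemma lie_rinehart_algebra_bracket:
  assumes "\<And>\<alpha> \<beta>. \<alpha> \<in> Omega \<Longrightarrow> \<beta> \<in> Omega \<Longrightarrow> \<alpha> Y \<otimes> \<beta> Y2 = \<beta> Y \<otimes> \<alpha> Y2"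
    and "\<And>\<alpha> \<beta>. \<alpha> \<in> Omega \<Longrightarrow> \<beta> \<in> Omega \<Longrightarrow> b \<alpha> \<beta> = bracket \<alpha> \<beta>"
  shows "lie_rinehart_algebra K R (Omega1 K R) b (\<lambda>\<alpha>. \<alpha> Y \<odot>\<^bsub>Der K R\<^esub> X)"
  by (rule lie_rinehart_algebra_if_flat_torsion_free[where conn = conn])
    (simp_all add: assms module_Omega1 conn_add_left conn_add_right conn_smult_left conn_leibniz
      conn_flat anchor_mod_hom anchor_bracket, simp_all add: bracket_def)

end

theorem corollary4p17:
  fixes K :: "('k, 'x) ring_scheme"
    and R :: "('k, 'r, 'y) module_scheme"
    and X Y :: "'r \<Rightarrow> 'r"
  assumes "field K" and "char_zero K"
    and "algebra K R"
    and "X \<in> carrier (Der K R)" and "Y \<in> carrier (Der K R)"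
    and symmetric:
      "\<forall>\<alpha>\<^sub>1 \<in> carrier (Omega1 K R). \<forall>\<alpha>\<^sub>2 \<in> carrier (Omega1 K R).
         \<langle>\<alpha>\<^sub>1, Y\<rangle> \<otimes>\<^bsub>R\<^esub> \<langle>\<alpha>\<^sub>2, commutator R X (commutator R X Y)\<rangle> =
         \<langle>\<alpha>\<^sub>2, Y\<rangle> \<otimes>\<^bsub>R\<^esub> \<langle>\<alpha>\<^sub>1, commutator R X (commutator R X Y)\<rangle>"
  shows "lie_rinehart_algebra K R (Omega1 K R)
    (\<lambda>\<alpha>\<^sub>1 \<alpha>\<^sub>2.
       \<langle>\<alpha>\<^sub>1, Y\<rangle> \<odot>\<^bsub>Omega1 K R\<^esub> lie_derivative K R X \<alpha>\<^sub>2
       \<ominus>\<^bsub>Omega1 K R\<^esub> \<langle>\<alpha>\<^sub>2, Y\<rangle> \<odot>\<^bsub>Omega1 K R\<^esub> lie_derivative K R X \<alpha>\<^sub>1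
       \<ominus>\<^bsub>Omega1 K R\<^esub> \<langle>\<alpha>\<^sub>1, commutator R X Y\<rangle> \<odot>\<^bsub>Omega1 K R\<^esub> \<alpha>\<^sub>2
       \<oplus>\<^bsub>Omega1 K R\<^esub> \<langle>\<alpha>\<^sub>2, commutator R X Y\<rangle> \<odot>\<^bsub>Omega1 K R\<^esub> \<alpha>\<^sub>1)
    (\<lambda>\<alpha>. \<langle>\<alpha>, Y\<rangle> \<odot>\<^bsub>Der K R\<^esub> X)"
proof -
  interpret derivation_pair K R X Y
    using assms by (simp add: derivation_pair_def derivation_pair_axioms_def commutative_algebra_def)
  show ?thesis
    unfolding pairing_def
    using symmetric[unfolded pairing_def]
    by (intro lie_rinehart_algebra_bracket) (simp_all add: bracket_eq)
qed

end
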